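(* Let $n\in\{0,1,2,\ldots\}$ and let $c,d$ be complex constants satisfying $\Re(d-c+n)>0$, with $d\notin\{1,0,-1,-2,\ldots\}$ and $c\notin\{1,2,\ldots,n+1\}$. Then $$ {}_3F_2\left(\begin{array}{c}1,\,1,\,c\\ d,\,n+2\end{array};1\right)=\frac{(n+1)\,\Gamma(d)}{(1-c)_{n+1}}\left\{\frac{(d-c)_n}{\Gamma(d-1)}\,\bigl[\psi(d-c+n)-\psi(d-1)\bigr]-\sum_{k=1}^n\binom{n}{k}\binom{n+1-c}{k}\frac{D_k(n)}{\Gamma(d-n-1+k)}\right\}, $$ where $$ D_k(n):=k!\,\{\psi(n+1)-\psi(n+1-k)\}\qquad(1\le k\le n). $$
   Context: For complex $a$ and integer $k\ge 0$, $(a)_k=\Gamma(a+k)/\Gamma(a)=a(a+1)\cdots(a+k-1)$ is Pochhammer's symbol, with $(a)_0=1$ (the product form being used when $a$ is a nonpositive integer). $\Gamma$ is the gamma function, with $1/\Gamma(z)=0$ when $z\in\{0,-1,-2,\ldots\}$, and $\psi(a)=\Gamma'(a)/\Gamma(a)$ is the psi (digamma) function. For complex $z$ and integer $k\ge 0$, $\binom{z}{k}=z(z-1)\cdots(z-k+1)/k!$ is the generalized binomial coefficient. The hypergeometric series of unit argument is $$ {}_3F_2\left(\begin{array}{c}1,\,1,\,c\\ d,\,n+2\end{array};1\right)=\sum_{m=0}^\infty\frac{(1)_m(1)_m(c)_m}{(d)_m(n+2)_m\,m!}. $$ An empty sum (the case $n=0$) equals $0$. *)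

theory Defs
  imports "HOL-Analysis.Analysis"
begin

definition hypergeom_3F2_term ::
  "complex \<Rightarrow> complex \<Rightarrow> complex \<Rightarrow> complex \<Rightarrow> complex \<Rightarrow> complex \<Rightarrow> nat \<Rightarrow> complex" where
  "hypergeom_3F2_term a1 a2 a3 b1 b2 z m =
     (pochhammer a1 m * pochhammer a2 m * pochhammer a3 m) /
     (pochhammer b1 m * pochhammer b2 m * fact m) * z ^ m"

(* A sum of a series that may diverge: statements about it should also assert summability. *)
definition hypergeom_3F2 ::
  "complex \<Rightarrow> complex \<Rightarrow> complex \<Rightarrow> complex \<Rightarrow> complex \<Rightarrow> complex \<Rightarrow> complex" where
  "hypergeom_3F2 a1 a2 a3 b1 b2 z = (\<Sum>m. hypergeom_3F2_term a1 a2 a3 b1 b2 z m)"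

lemma hypergeom_3F2_eq_eval_fps:
  "hypergeom_3F2 a1 a2 a3 b1 b2 z = eval_fps (fps_hypergeo [a1, a2, a3] [b1, b2] 1) z"
  by (simp add: hypergeom_3F2_def hypergeom_3F2_term_def eval_fps_def)

definition D_coeff :: "nat \<Rightarrow> nat \<Rightarrow> complex" where
  "D_coeff n k = fact k * (Digamma (of_nat n + 1) - Digamma (of_nat n + 1 - of_nat k))"

end

(*
  Differentiate Gauss's formula
    sum_k (a)_k (b)_k / (k! Gamma(e+k)) = Gamma(e-a-b) / (Gamma(e-a) Gamma(e-b))
  in the parameter a at a = -n, with b = c-n-1 and e = d-n-1.  The derivative of (a)_k / k! at -n
  is (-1)^n n! (k-n-1)! / k! for k > n, so the terms with k > n are multiples of the terms of the
  3F2 series; the terms with 1 <= k <= n give the finite sum with D_k(n), and the logarithmic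
  derivative of the right-hand side gives the digamma functions.

  The differentiated formula is proved without differentiating under the sum.  The differentiated
  telescoping relation between the series at e and e+1 shows that, up to explicit factors, the
  difference of both sides is invariant under e -> e+1, and it tends to 0 along e + N.
*)
theory Submission
  imports Defs
begin

section \<open>Derivatives of the Pochhammer coefficients at a negative integer\<close>

text \<open>The derivative of \<open>pochhammer a k / fact k\<close> with respect to \<open>a\<close> at \<open>a = - of_nat n\<close>:
  the recurrence is the derivative of \<open>(k + 1) g\<^sub>k\<^sub>+\<^sub>1 = (a + k) g\<^sub>k\<close>, where at \<open>a = -n\<close> the value
  of \<open>g\<^sub>k\<close> is \<open>(-1)\<^sup>k\<close> times a binomial coefficient.\<close>

primrec poch_deriv :: "nat \<Rightarrow> nat \<Rightarrow> complex" where
  "poch_deriv n 0 = 0"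
| "poch_deriv n (Suc k) =
     ((of_nat k - of_nat n) * poch_deriv n k + (-1) ^ k * of_nat (n choose k)) / of_nat (Suc k)"

lemma poch_deriv_Suc_mult:
  "of_nat (Suc k) * poch_deriv n (Suc k) =
     (of_nat k - of_nat n) * poch_deriv n k + (-1) ^ k * of_nat (n choose k)"
  by (simp del: of_nat_Suc)

declare poch_deriv.simps(2) [simp del]

lemma binomial_absorb_complex:
  "of_nat (Suc k) * of_nat (n choose Suc k) = (of_nat n - of_nat k) * (of_nat (n choose k) :: complex)"
  using gbinomial_mult_1[of "of_nat n :: complex" k]
  by (simp add: binomial_gbinomial algebra_simps)

text \<open>For k <= n no factor of (a)_k vanishes at a = -n, so the logarithmic derivative applies:
  it is the sum of 1/(j - n) over j < k, that is -(H_n - H_{n-k}), and (-n)_k / k! is the signed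
  binomial coefficient.\<close>

lemma poch_deriv_le:
  assumes "k \<le> n"
  shows "poch_deriv n k = - ((-1) ^ k * of_nat (n choose k) * (harm n - harm (n - k)))"
  using assms
proof (induction k)
  case (Suc k)
  define m where "m = n - Suc k"
  have n: "n - k = Suc m" "n = Suc (m + k)" using Suc.prems by (auto simp: m_def)
  have nk: "(of_nat n - of_nat k :: complex) = of_nat (Suc m)" by (simp add: n)
  have IH: "poch_deriv n k = - ((-1) ^ k * of_nat (n choose k) * (harm n - (harm m + 1 / of_nat (Suc m))))"
    using Suc by (simp add: n harm_Suc inverse_eq_divide del: of_nat_Suc)
  have B: "of_nat (Suc k) * of_nat (n choose Suc k) = of_nat (Suc m) * (of_nat (n choose k) :: complex)"
    using binomial_absorb_complex[of k n] unfolding nk .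
  have "of_nat (Suc k) * poch_deriv n (Suc k) =
      - of_nat (Suc m) * poch_deriv n k + (-1) ^ k * of_nat (n choose k)"
    unfolding poch_deriv_Suc_mult using nk by (simp add: algebra_simps)
  also have "\<dots> = (-1) ^ k * (of_nat (Suc m) * of_nat (n choose k)) * (harm n - harm m)"
    unfolding IH by (simp add: field_simps del: of_nat_Suc)
  also have "\<dots> = (-1) ^ k * (of_nat (Suc k) * of_nat (n choose Suc k)) * (harm n - harm m)"
    by (simp only: B)
  also have "\<dots> = of_nat (Suc k) * (- ((-1) ^ Suc k * of_nat (n choose Suc k) * (harm n - harm m)))"
    by simp
  finally have "of_nat (Suc k) * poch_deriv n (Suc k) = \<dots>" .
  hence "poch_deriv n (Suc k) = - ((-1) ^ Suc k * of_nat (n choose Suc k) * (harm n - harm m))"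
    unfolding mult_left_cancel[OF of_nat_neq_0] .
  thus ?case by (simp add: m_def)
qed simp

text \<open>For k = n + 1 + m exactly one factor of (a)_k, namely a + n, vanishes at a = -n, so the
  derivative is the product of the other factors. In the recurrence this appears as follows: the
  step from n to n + 1 leaves only (-1)^n, and afterwards the binomial term is zero.\<close>

lemma poch_deriv_gt:
  "poch_deriv n (n + 1 + m) = (-1) ^ n * (fact n * fact m / fact (n + 1 + m))"
proof (induction m)
  case 0
  have "of_nat (Suc n) * poch_deriv n (Suc n) = (-1) ^ n"
    by (simp only: poch_deriv_Suc_mult) simp
  thus ?case by (simp add: field_simps del: of_nat_Suc)
next
  case (Suc m)
  have "of_nat (Suc (n + 1 + m)) * poch_deriv n (Suc (n + 1 + m)) =
      of_nat (Suc m) * poch_deriv n (n + 1 + m)"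
    unfolding poch_deriv_Suc_mult by simp
  thus ?case unfolding Suc
    by (simp add: field_simps del: of_nat_Suc)
qed

section \<open>Terms of the differentiated Gauss series and their telescoping relation\<close>

text \<open>The reciprocal Gamma function replaces division by Pochhammer symbols in e because e = d
  - n - 1 may be a nonpositive integer.\<close>

definition deriv_term :: "nat \<Rightarrow> complex \<Rightarrow> complex \<Rightarrow> nat \<Rightarrow> complex" where
  "deriv_term n b e k = poch_deriv n k * pochhammer b k * rGamma (e + of_nat k)"

text \<open>Put t_k(e) = (a)_k (b)_k / (k! Gamma(e+k)). Then (e-a-b) t_k(e) - (e-a)(e-b) t_k(e+1) =
  s_k - s_{k+1} with s_k = k t_k(e). This is the derivative of that identity in a at a = -n; the
  last bracket on the left comes from differentiating the coefficients.\<close>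

lemma deriv_term_telescope:
  fixes b e :: complex and n k :: nat
  defines "s \<equiv> (\<lambda>k. of_nat k * poch_deriv n k * pochhammer b k * rGamma (e + of_nat k))"
  shows "(e + of_nat n - b) * (poch_deriv n k * pochhammer b k * rGamma (e + of_nat k))
     - (e + of_nat n) * (e - b) * (poch_deriv n k * pochhammer b k * rGamma (e + 1 + of_nat k))
     - ((-1) ^ k * of_nat (n choose k) * pochhammer b k * rGamma (e + of_nat k)
        - (e - b) * ((-1) ^ k * of_nat (n choose k) * pochhammer b k * rGamma (e + 1 + of_nat k)))
     = s k - s (Suc k)"
proof -
  have r: "rGamma (e + of_nat k) = (e + of_nat k) * rGamma (e + 1 + of_nat k)"
    using rGamma_plus1[of "e + of_nat k"] by (simp add: add_ac)
  have r1: "rGamma (e + of_nat (Suc k)) = rGamma (e + 1 + of_nat k)" by (simp add: add_ac)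
  have "s (Suc k) = ((of_nat k - of_nat n) * poch_deriv n k + (-1) ^ k * of_nat (n choose k))
          * ((b + of_nat k) * pochhammer b k) * rGamma (e + 1 + of_nat k)"
    unfolding s_def poch_deriv_Suc_mult r1 pochhammer_rec' ..
  moreover have "s k = of_nat k * poch_deriv n k * pochhammer b k *
      ((e + of_nat k) * rGamma (e + 1 + of_nat k))"
    unfolding s_def r ..
  ultimately show ?thesis unfolding r by (simp add: algebra_simps)
qed

text \<open>Gauss's sum itself at a = -n, where it terminates; it evaluates the undifferentiated
  terms of the telescoping relation. Reflecting (e+k)_{n-k} into a signed (1-e-n)_{n-k} turns it
  into the binomial theorem for Pochhammer symbols.\<close>

lemma Chu_Vandermonde_rGamma:
  fixes b e :: complex
  shows "(\<Sum>k\<le>n. (-1) ^ k * of_nat (n choose k) * pochhammer b k * rGamma (e + of_nat k)) =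
     pochhammer (e - b) n * rGamma (e + of_nat n)"
proof -
  have "(-1) ^ k * of_nat (n choose k) * pochhammer b k * rGamma (e + of_nat k) =
      (-1) ^ n * (of_nat (n choose k) * pochhammer b k * pochhammer (1 - e - of_nat n) (n - k))
        * rGamma (e + of_nat n)" if "k \<le> n" for k
  proof -
    have "rGamma (e + of_nat k) = pochhammer (e + of_nat k) (n - k) * rGamma (e + of_nat n)"
      using pochhammer_rGamma[of "e + of_nat k" "n - k"] that by (simp add: of_nat_diff)
    also have "pochhammer (e + of_nat k) (n - k) = (-1) ^ (n - k) * pochhammer (1 - e - of_nat n) (n - k)"
      using pochhammer_minus'[of "e + of_nat n - 1" "n - k"] that by (simp add: of_nat_diff algebra_simps)
    finally show ?thesis
      using that by (simp add: power_add[symmetric] flip: mult.assoc)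
  qed
  hence "(\<Sum>k\<le>n. (-1) ^ k * of_nat (n choose k) * pochhammer b k * rGamma (e + of_nat k)) =
      (\<Sum>k\<le>n. (-1) ^ n * (of_nat (n choose k) * pochhammer b k * pochhammer (1 - e - of_nat n) (n - k))
        * rGamma (e + of_nat n))"
    by (intro sum.cong) auto
  also have "\<dots> = (-1) ^ n * pochhammer (b + (1 - e - of_nat n)) n * rGamma (e + of_nat n)"
    by (simp add: pochhammer_binomial_sum sum_distrib_left sum_distrib_right)
  also have "(-1) ^ n * pochhammer (b + (1 - e - of_nat n)) n = pochhammer (e - b) n"
    using pochhammer_minus'[of "e - b + of_nat n - 1" n] by (simp add: algebra_simps minus_diff_eq)
  finally show ?thesis .
qed

section \<open>Growth of the terms and convergence\<close>

lemma Re_pos_notin_nonpos_Ints: "Re z > 0 \<Longrightarrow> z \<notin> \<int>\<^sub>\<le>\<^sub>0"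
  by (auto elim!: nonpos_Ints_cases)

text \<open>\<open>rGamma_series z m\<close> is (z)_{m+1} / (m! m^z) and converges to 1/Gamma(z).
  The quotient for z and w therefore converges, as 1/Gamma(w) is nonzero, and so is bounded; what
  remains is m^(z-w).\<close>

lemma pochhammer_ratio_bound:
  fixes z w :: complex
  assumes w: "w \<notin> \<int>\<^sub>\<le>\<^sub>0"
  obtains C where "C > 0" and
    "\<And>m. m \<ge> 1 \<Longrightarrow> norm (pochhammer z (Suc m) / pochhammer w (Suc m)) \<le> C * real m powr Re (z - w)"
proof -
  have "(\<lambda>m. rGamma_series z m / rGamma_series w m) \<longlonglongrightarrow> rGamma z / rGamma w"
    using w by (intro tendsto_intros) (simp add: rGamma_eq_zero_iff)
  from Bseq_iff[THEN iffD1, OF convergent_imp_Bseq[OF convergentI[OF this]]]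
  obtain K where K: "\<And>m. norm (rGamma_series z m / rGamma_series w m) \<le> real (Suc K)" by blast
  show ?thesis
  proof
    show "real (Suc K) > 0" by simp
    fix m :: nat assume m: "m \<ge> 1"
    have "pochhammer z (Suc m) / pochhammer w (Suc m) =
        rGamma_series z m / rGamma_series w m * exp ((z - w) * of_real (ln (real m)))"
      by (simp add: rGamma_series_def left_diff_distrib exp_diff field_simps)
    hence "norm (pochhammer z (Suc m) / pochhammer w (Suc m)) =
        norm (rGamma_series z m / rGamma_series w m) * real m powr Re (z - w)"
      using m by (simp add: norm_mult norm_divide powr_def)
    thus "norm (pochhammer z (Suc m) / pochhammer w (Suc m)) \<le> real (Suc K) * real m powr Re (z - w)"
      using K[of m] by (simp add: mult_right_mono)
  qed
qed

lemma hypergeom_3F2_term_1_1: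
  "hypergeom_3F2_term 1 1 c d e 1 m = (pochhammer 1 m / pochhammer e m) * (pochhammer c m / pochhammer d m)"
  by (simp add: hypergeom_3F2_term_def pochhammer_fact)

text \<open>The two Pochhammer quotients contribute the exponents -1 - n and Re (c - d), which add
  up to one below -1 exactly when Re (d - c + n) > 0.\<close>

lemma hypergeom_3F2_term_bound:
  fixes c d :: complex and n :: nat
  assumes "d \<notin> \<int>\<^sub>\<le>\<^sub>0"
  obtains C where "C > 0" and
    "\<And>m. m \<ge> 1 \<Longrightarrow> norm (hypergeom_3F2_term 1 1 c d (of_nat n + 2) 1 (Suc m))
       \<le> C * real m powr (- 1 - Re (d - c + of_nat n))"
proof -
  have n2: "of_nat n + 2 \<notin> (\<int>\<^sub>\<le>\<^sub>0 :: complex set)"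
    by (rule Re_pos_notin_nonpos_Ints) simp
  obtain A where A: "A > 0" "\<And>m. m \<ge> 1 \<Longrightarrow>
      norm (pochhammer 1 (Suc m) / pochhammer (of_nat n + 2 :: complex) (Suc m)) \<le>
        A * real m powr Re (1 - (of_nat n + 2 :: complex))"
    using pochhammer_ratio_bound[OF n2, of 1] by blast
  obtain B where B: "B > 0" "\<And>m. m \<ge> 1 \<Longrightarrow>
      norm (pochhammer c (Suc m) / pochhammer d (Suc m)) \<le> B * real m powr Re (c - d)"
    using pochhammer_ratio_bound[OF assms, of c] by blast
  show ?thesis
  proof
    show "A * B > 0" using A B by simp
    fix m :: nat assume m: "m \<ge> 1"
    have "norm (hypergeom_3F2_term 1 1 c d (of_nat n + 2) 1 (Suc m)) \<le>
        (A * real m powr Re (1 - (of_nat n + 2 :: complex))) * (B * real m powr Re (c - d))"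
      unfolding hypergeom_3F2_term_1_1 norm_mult
      using A(1) by (intro mult_mono A(2) B(2) m) auto
    also have "\<dots> = A * B * real m powr (Re (1 - (of_nat n + 2 :: complex)) + Re (c - d))"
      by (simp add: powr_add mult_ac)
    also have "Re (1 - (of_nat n + 2 :: complex)) + Re (c - d) = - 1 - Re (d - c + of_nat n)" by simp
    finally show "norm (hypergeom_3F2_term 1 1 c d (of_nat n + 2) 1 (Suc m)) \<le>
        A * B * real m powr (- 1 - Re (d - c + of_nat n))" .
  qed
qed

lemma summable_hypergeom_3F2_term:
  fixes c d :: complex and n :: nat
  assumes "d \<notin> \<int>\<^sub>\<le>\<^sub>0" "Re (d - c + of_nat n) > 0"
  shows "summable (hypergeom_3F2_term 1 1 c d (of_nat n + 2) 1)"
proof -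
  obtain C where C: "\<And>m. m \<ge> 1 \<Longrightarrow> norm (hypergeom_3F2_term 1 1 c d (of_nat n + 2) 1 (Suc m))
       \<le> C * real m powr (- 1 - Re (d - c + of_nat n))"
    using hypergeom_3F2_term_bound[OF assms(1)] by blast
  have "summable (\<lambda>m. C * real m powr (- 1 - Re (d - c + of_nat n)))"
    using assms(2) by (intro summable_mult) (simp add: summable_real_powr_iff)
  hence "summable (\<lambda>m. hypergeom_3F2_term 1 1 c d (of_nat n + 2) 1 (Suc m))"
    by (rule summable_comparison_test') (use C in auto)
  thus ?thesis by (subst (asm) summable_Suc_iff)
qed

text \<open>Every factor is split at n + 1: (c-n-1)_{n+1+m} into (c-n-1)_{n+1} (c)_m, Gamma(d+m)
  into Gamma(d) (d)_m, and (n+1+m)! into (n+1)! (n+2)_m. Reflection turns (c-n-1)_{n+1} into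
  (-1)^(n+1) (1-c)_{n+1}, and the signs combine to -1.\<close>

lemma poch_deriv_tail:
  fixes c d :: complex
  assumes "d \<notin> \<int>\<^sub>\<le>\<^sub>0"
  shows "poch_deriv n (n + 1 + m) * pochhammer (c - of_nat n - 1) (n + 1 + m)
      * rGamma (d - of_nat n - 1 + of_nat (n + 1 + m)) =
    - pochhammer (1 - c) (n + 1) * rGamma d / (of_nat n + 1) *
      hypergeom_3F2_term 1 1 c d (of_nat n + 2) 1 m"
proof -
  have dm: "pochhammer d m \<noteq> 0" using assms by (auto simp: pochhammer_eq_0_iff)
  have "rGamma (d - of_nat n - 1 + of_nat (n + 1 + m)) = rGamma (d + of_nat m)" by (simp add: algebra_simps)
  hence r: "rGamma (d - of_nat n - 1 + of_nat (n + 1 + m)) = rGamma d / pochhammer d m"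
    using pochhammer_rGamma[of d m] dm by (simp add: field_simps)
  have "pochhammer (c - of_nat n - 1) (n + 1 + m) =
      pochhammer (c - of_nat n - 1) (n + 1) * pochhammer c m"
    unfolding pochhammer_product'[of _ "n + 1" m] by simp
  moreover have "pochhammer (c - of_nat n - 1) (n + 1) = (-1) ^ (n + 1) * pochhammer (1 - c) (n + 1)"
    using pochhammer_minus'[of "c - 1" "n + 1"] by (simp add: algebra_simps)
  ultimately have p: "pochhammer (c - of_nat n - 1) (n + 1 + m) =
      (-1) ^ (n + 1) * pochhammer (1 - c) (n + 1) * pochhammer c m" by simp
  have "(fact (n + 1 + m) :: complex) = fact (n + 1) * pochhammer (of_nat n + 2) m"
    using pochhammer_product'[of "1 :: complex" "n + 1" m] by (simp add: pochhammer_fact add_ac)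
  moreover have "(fact (n + 1) :: complex) = (of_nat n + 1) * fact n" by simp
  ultimately have f: "(fact (n + 1 + m) :: complex) = (of_nat n + 1) * fact n * pochhammer (of_nat n + 2) m" by simp
  define q :: complex where "q = of_nat n + 1"
  have s: "(-1) ^ n * ((-1) ^ (n + 1) * x) = - x" for x :: complex
    by (simp flip: power_add mult_2 mult.assoc)
  show ?thesis
    unfolding poch_deriv_gt r p f hypergeom_3F2_term_1_1 pochhammer_fact[symmetric] q_def[symmetric]
    using s[of "fact m"] by (simp add: field_simps)
qed

lemma deriv_term_bound:
  assumes "e + of_nat n + 1 \<notin> \<int>\<^sub>\<le>\<^sub>0"
  obtains C where "C > 0" and
    "\<And>m. m \<ge> 1 \<Longrightarrow> norm (deriv_term n b e (m + (n + 2))) \<le> C * real m powr (- 1 - Re (e - b + of_nat n))"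
proof -
  define c d where "c = b + of_nat n + 1" and "d = e + of_nat n + 1"
  have be: "b = c - of_nat n - 1" "e = d - of_nat n - 1" by (simp_all add: c_def d_def)
  have d: "d \<notin> \<int>\<^sub>\<le>\<^sub>0" using assms by (simp add: d_def)
  obtain C where C: "C > 0" "\<And>m. m \<ge> 1 \<Longrightarrow> norm (hypergeom_3F2_term 1 1 c d (of_nat n + 2) 1 (Suc m))
       \<le> C * real m powr (- 1 - Re (d - c + of_nat n))"
    using hypergeom_3F2_term_bound[OF d] by blast
  define K where "K = norm (- pochhammer (1 - c) (n + 1) * rGamma d / (of_nat n + 1))"
  have K: "norm (deriv_term n b e (m + (n + 2))) = K * norm (hypergeom_3F2_term 1 1 c d (of_nat n + 2) 1 (Suc m))" for m
  proof -
    have "deriv_term n b e (n + 1 + Suc m) = - pochhammer (1 - c) (n + 1) * rGamma d / (of_nat n + 1) *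
      hypergeom_3F2_term 1 1 c d (of_nat n + 2) 1 (Suc m)"
      unfolding deriv_term_def be by (rule poch_deriv_tail[OF d])
    thus ?thesis unfolding K_def norm_mult[symmetric] by (simp add: add_ac)
  qed
  have "K \<ge> 0" by (simp add: K_def)
  show ?thesis
  proof
    \<comment> \<open>\<open>K\<close> is zero when (1-c)_{n+1} is, so \<open>K + 1\<close> keeps
      the constant positive.\<close>
    show "(K + 1) * C > 0" using C \<open>K \<ge> 0\<close> by simp
    fix m :: nat assume m: "m \<ge> 1"
    have "norm (deriv_term n b e (m + (n + 2))) \<le> (K + 1) * norm (hypergeom_3F2_term 1 1 c d (of_nat n + 2) 1 (Suc m))"
      unfolding K by (intro mult_right_mono) auto
    also have "\<dots> \<le> (K + 1) * (C * real m powr (- 1 - Re (d - c + of_nat n)))"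
      using \<open>K \<ge> 0\<close> by (intro mult_left_mono C m) auto
    finally show "norm (deriv_term n b e (m + (n + 2))) \<le> (K + 1) * C * real m powr (- 1 - Re (e - b + of_nat n))"
      by (simp add: c_def d_def mult_ac)
  qed
qed

text \<open>With r = Re (e - b + n) > 0 the terms decay like k^(-1-r). This is summable, and a
  further factor k still leaves k^(-r), which removes the boundary term at infinity when the
  relation is telescoped.\<close>

lemma
  assumes "e + of_nat n + 1 \<notin> \<int>\<^sub>\<le>\<^sub>0" and pos: "Re (e - b + of_nat n) > 0"
  shows summable_deriv_term: "summable (deriv_term n b e)"
    and deriv_term_tendsto: "(\<lambda>k. of_nat k * deriv_term n b e k) \<longlonglongrightarrow> 0"
proof -
  define r where "r = Re (e - b + of_nat n)"
  obtain C where C: "C > 0" "\<And>m. m \<ge> 1 \<Longrightarrow> norm (deriv_term n b e (m + (n + 2))) \<le> C * real m powr (- 1 - r)"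
    unfolding r_def using deriv_term_bound[OF assms(1)] by blast
  have r: "r > 0" using pos by (simp add: r_def)
  have "summable (\<lambda>m. C * real m powr (- 1 - r))"
    using r by (intro summable_mult) (simp add: summable_real_powr_iff)
  hence "summable (\<lambda>m. deriv_term n b e (m + (n + 2)))"
    by (rule summable_comparison_test') (use C in auto)
  thus "summable (deriv_term n b e)" by (subst (asm) summable_iff_shift)
  have "(\<lambda>m. (real n + 3) * C * real m powr (- r)) \<longlonglongrightarrow> (real n + 3) * C * 0"
    using r by (intro tendsto_intros tendsto_neg_powr filterlim_real_sequentially) auto
  hence lim: "(\<lambda>m. (real n + 3) * C * real m powr (- r)) \<longlonglongrightarrow> 0" by simp
  have "(\<lambda>m. of_nat (m + (n + 2)) * deriv_term n b e (m + (n + 2))) \<longlonglongrightarrow> 0"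
  proof (rule Lim_null_comparison[OF _ lim], rule eventually_sequentiallyI[of 1])
    fix m :: nat assume m: "m \<ge> 1"
    have "norm (of_nat (m + (n + 2)) * deriv_term n b e (m + (n + 2))) =
        real (m + (n + 2)) * norm (deriv_term n b e (m + (n + 2)))"
      by (simp only: norm_mult norm_of_nat)
    also have "real (m + (n + 2)) \<le> (real n + 3) * real m"
    proof -
      have "real (n + 2) * 1 \<le> real (n + 2) * real m" using m by (intro mult_left_mono) auto
      thus ?thesis by (simp add: algebra_simps)
    qed
    also have "(real n + 3) * real m * norm (deriv_term n b e (m + (n + 2))) \<le>
        (real n + 3) * real m * (C * real m powr (- 1 - r))"
      using m by (intro mult_left_mono C) auto
    also have "\<dots> = (real n + 3) * C * (real m powr 1 * real m powr (- 1 - r))"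
      using m by simp
    also have "real m powr 1 * real m powr (- 1 - r) = real m powr (- r)"
      unfolding powr_add[symmetric] by simp
    finally show "norm (of_nat (m + (n + 2)) * deriv_term n b e (m + (n + 2))) \<le> (real n + 3) * C * real m powr (- r)"
      by (simp add: mult_right_mono)
  qed
  thus "(\<lambda>k. of_nat k * deriv_term n b e k) \<longlonglongrightarrow> 0"
    by (rule LIMSEQ_offset)
qed

section \<open>Recurrence between the series at e and at e + 1\<close>

text \<open>Obtained by summing \<open>deriv_term_telescope\<close> over all k: the undifferentiated
  terms are summed by Chu-Vandermonde, and the telescoping part has boundary values 0 at both
  ends.\<close>

lemma suminf_deriv_term_recurrence:
  assumes "e + of_nat n + 1 \<notin> \<int>\<^sub>\<le>\<^sub>0" "e + of_nat n + 2 \<notin> \<int>\<^sub>\<le>\<^sub>0" and pos: "Re (e - b + of_nat n) > 0"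
  shows "(e + of_nat n - b) * (\<Sum>k. deriv_term n b e k) - pochhammer (e - b) n * rGamma (e + of_nat n) =
    (e + of_nat n) * (e - b) * (\<Sum>k. deriv_term n b (e + 1) k)
      - (e - b) * (pochhammer (e + 1 - b) n * rGamma (e + 1 + of_nat n))"
proof -
  define f where "f = (\<lambda>e k. (-1) ^ k * of_nat (n choose k) * pochhammer b k * rGamma (e + of_nat k))"
  have f: "f x sums (pochhammer (x - b) n * rGamma (x + of_nat n))" for x
    unfolding Chu_Vandermonde_rGamma[symmetric] f_def
    by (rule sums_finite) (auto simp: binomial_eq_0)
  have H: "deriv_term n b e sums (\<Sum>k. deriv_term n b e k)"
    using summable_deriv_term[of e n b] assms by (auto simp: summable_sums)
  have H1: "deriv_term n b (e + 1) sums (\<Sum>k. deriv_term n b (e + 1) k)"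
    using assms by (intro summable_sums summable_deriv_term) (auto simp: algebra_simps)
  define s where "s = (\<lambda>k. of_nat k * deriv_term n b e k)"
  have T: "(e + of_nat n - b) * deriv_term n b e k - (e + of_nat n) * (e - b) * deriv_term n b (e + 1) k
      - (f e k - (e - b) * f (e + 1) k) = s k - s (Suc k)" for k
    using deriv_term_telescope[of e n b k] by (simp add: s_def f_def deriv_term_def mult_ac)
  have "(\<lambda>k. s k - s (Suc k)) sums
    ((e + of_nat n - b) * (\<Sum>k. deriv_term n b e k) - (e + of_nat n) * (e - b) * (\<Sum>k. deriv_term n b (e + 1) k)
      - (pochhammer (e - b) n * rGamma (e + of_nat n)
         - (e - b) * (pochhammer (e + 1 - b) n * rGamma (e + 1 + of_nat n))))"
    unfolding T[symmetric] by (intro sums_diff sums_mult H H1 f)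
  moreover have "(\<lambda>k. s k - s (Suc k)) sums (s 0 - 0)"
    unfolding s_def by (rule telescope_sums') (rule deriv_term_tendsto[OF assms(1,3)])
  ultimately have "(e + of_nat n - b) * (\<Sum>k. deriv_term n b e k) - (e + of_nat n) * (e - b) * (\<Sum>k. deriv_term n b (e + 1) k)
      - (pochhammer (e - b) n * rGamma (e + of_nat n)
         - (e - b) * (pochhammer (e + 1 - b) n * rGamma (e + 1 + of_nat n))) = s 0 - 0"
    by (rule sums_unique2)
  thus ?thesis by (simp add: s_def algebra_simps)
qed

section \<open>Behaviour of the normalised series along e + N\<close>

lemma tendsto_pochhammer_shift:
  fixes z :: complex
  shows "(\<lambda>N. pochhammer (z + of_nat N) k / of_nat N ^ k) \<longlonglongrightarrow> 1"
proof (induction k)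
  case (Suc k)
  have "(\<lambda>N. (z + of_nat k) * inverse (of_nat N) + 1) \<longlonglongrightarrow> (z + of_nat k) * 0 + 1"
    by (intro tendsto_intros lim_inverse_n)
  from tendsto_mult[OF Suc this]
  have "(\<lambda>N. pochhammer (z + of_nat N) k / of_nat N ^ k * ((z + of_nat k) * inverse (of_nat N) + 1)) \<longlonglongrightarrow> 1" by simp
  thus ?case
    by (rule Lim_transform_eventually, intro eventually_sequentiallyI[of 1]) (auto simp: pochhammer_Suc field_simps)
qed auto

lemma norm_pochhammer_le:
  fixes z :: complex
  assumes "norm z \<le> x"
  shows "norm (pochhammer z k) \<le> pochhammer x k"
  unfolding pochhammer_prod prod_norm[symmetric]
  by (intro prod_mono conjI norm_ge_zero norm_triangle_le) (use assms in simp)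

lemma norm_pochhammer_ge:
  fixes z :: complex
  assumes "0 \<le> x" "x \<le> Re z"
  shows "norm (pochhammer z k) \<ge> pochhammer x k"
  unfolding pochhammer_prod prod_norm[symmetric]
proof (intro prod_mono conjI)
  fix i
  have "x + real i \<le> Re (z + of_nat i)" using assms by simp
  also have "\<dots> \<le> norm (z + of_nat i)" by (rule complex_Re_le_cmod)
  finally show "x + of_nat i \<le> norm (z + of_nat i)" by simp
qed (use assms in auto)

text \<open>The norm equals 1 / ((m+1) binom(n+m+1, n)), and the binomial coefficient is at least 1;
  this is the divisibility used below.\<close>

lemma norm_poch_deriv_tail_le: "norm (poch_deriv n (n + 1 + m)) \<le> 1 / real (m + 1)"
proof -
  have "fact n * fact (m + 1) \<le> (fact (n + (m + 1)) :: nat)"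
    by (intro dvd_imp_le fact_fact_dvd_fact) auto
  hence "fact n * fact (m + 1) \<le> (fact (n + (m + 1)) :: real)"
    by (simp only: of_nat_mult of_nat_fact flip: of_nat_le_iff[where ?'a = real])
  moreover have "real (m + 1) * (fact n * fact m) = fact n * fact (m + 1)" by simp
  ultimately have "real (m + 1) * (fact n * fact m) \<le> fact (n + (m + 1))" by (simp only:)
  hence "fact n * fact m / fact (n + 1 + m) \<le> 1 / real (m + 1)"
    by (simp add: field_simps del: fact_Suc of_nat_Suc)
  thus ?thesis unfolding poch_deriv_gt by (simp add: norm_mult norm_divide norm_power del: fact_Suc)
qed

text \<open>Apart from 1 / Re (e + n) the bound does not depend on e, and it is summable in m, so
  the whole tail vanishes as Re e grows. One factor 1/(m+1) comes from the coefficient, the other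
  from the quotient of Pochhammer symbols.\<close>

lemma norm_deriv_term_Gamma_le:
  fixes b e :: complex and n m :: nat
  defines "\<beta> \<equiv> norm b + real n + 1"
  assumes y: "Re (e + of_nat n) \<ge> \<beta> + 1"
  shows "norm (deriv_term n b e (n + 1 + m) * Gamma (e + of_nat n)) \<le>
    norm (pochhammer b n) * (\<beta> * (\<beta> + 1)) / Re (e + of_nat n) * (1 / real (m + 1) ^ 2)"
proof -
  define z y where "z = e + of_nat n" and "y = Re z"
  have y: "y \<ge> \<beta> + 1" using assms by (simp add: y_def z_def)
  have \<beta>: "\<beta> \<ge> 1" by (simp add: \<beta>_def)
  have z: "z \<notin> \<int>\<^sub>\<le>\<^sub>0" using y \<beta> by (intro Re_pos_notin_nonpos_Ints) (simp add: y_def)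
  have pz: "pochhammer z k \<noteq> 0" for k using z by (auto simp: pochhammer_eq_0_iff)
  have "rGamma z = pochhammer z (m + 1) * rGamma (e + of_nat (n + 1 + m))"
    using pochhammer_rGamma[of z "m + 1"] by (simp add: z_def add_ac)
  hence "rGamma (e + of_nat (n + 1 + m)) = rGamma z / pochhammer z (m + 1)"
    using pz[of "m + 1"] by (simp add: field_simps)
  moreover have "rGamma z * Gamma z = 1" using z by (simp add: Gamma_eq_zero_iff rGamma_inverse_Gamma)
  ultimately have "rGamma (e + of_nat (n + 1 + m)) * Gamma z = 1 / pochhammer z (m + 1)" by simp
  moreover have "pochhammer b (n + 1 + m) = pochhammer b n * pochhammer (b + of_nat n) (m + 1)"
    using pochhammer_product'[of b n "m + 1"] by (simp add: add_ac)
  ultimately have eq: "deriv_term n b e (n + 1 + m) * Gamma z =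
      poch_deriv n (n + 1 + m) * (pochhammer b n * (pochhammer (b + of_nat n) (m + 1) / pochhammer z (m + 1)))"
    unfolding deriv_term_def by (simp add: mult.assoc)
  have p2: "pochhammer (\<beta> + 2) m > 0" using \<beta> by (intro pochhammer_pos) auto
  have p1: "pochhammer y (m + 1) > 0" using \<beta> y by (intro pochhammer_pos) auto
  have "norm (pochhammer (b + of_nat n) (m + 1)) \<le> pochhammer \<beta> (m + 1)"
    by (rule norm_pochhammer_le) (use norm_triangle_ineq[of b "of_nat n"] in \<open>simp add: \<beta>_def\<close>)
  \<comment> \<open>Moving the base from \<open>\<beta>\<close> to \<open>\<beta> + 2\<close> drops
    the two lowest factors and adds one at the top; dividing by the latter yields the second
    1/(m+1).\<close>
  also have "pochhammer \<beta> (m + 1) = \<beta> * (\<beta> + 1) * pochhammer (\<beta> + 2) m / (\<beta> + 1 + real m)"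
  proof -
    have "pochhammer (\<beta> + 1) m * (\<beta> + 1 + real m) = (\<beta> + 1) * pochhammer (\<beta> + 1 + 1) m"
      unfolding pochhammer_rec[symmetric] pochhammer_Suc ..
    moreover have "\<beta> + 1 + real m > 0" using \<beta> by simp
    ultimately show ?thesis by (simp add: pochhammer_rec field_simps add_ac)
  qed
  also have "\<dots> \<le> \<beta> * (\<beta> + 1) * pochhammer (\<beta> + 2) m / real (m + 1)"
    using \<beta> p2 by (intro divide_left_mono mult_nonneg_nonneg) auto
  finally have num: "norm (pochhammer (b + of_nat n) (m + 1)) \<le> \<beta> * (\<beta> + 1) * pochhammer (\<beta> + 2) m / real (m + 1)" .
  \<comment> \<open>Only the first factor y of the denominator is kept; since y >=
    \<open>\<beta> + 1\<close>, the others dominate \<open>pochhammer (\<beta> + 2) m\<close>, which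
    then cancels.\<close>
  have "y * pochhammer (\<beta> + 2) m \<le> y * pochhammer (y + 1) m"
    using y \<beta> unfolding pochhammer_prod by (intro mult_left_mono prod_mono) auto
  also have "\<dots> = pochhammer y (m + 1)" by (simp add: pochhammer_rec)
  also have "\<dots> \<le> norm (pochhammer z (m + 1))"
    using y \<beta> by (intro norm_pochhammer_ge) (auto simp: y_def)
  finally have den: "y * pochhammer (\<beta> + 2) m \<le> norm (pochhammer z (m + 1))" .
  have "norm (pochhammer (b + of_nat n) (m + 1) / pochhammer z (m + 1)) \<le>
      \<beta> * (\<beta> + 1) * pochhammer (\<beta> + 2) m / real (m + 1) / (y * pochhammer (\<beta> + 2) m)"
    unfolding norm_divide using \<beta> y p2 by (intro frac_le num den) auto
  also have "\<dots> = \<beta> * (\<beta> + 1) / y / real (m + 1)" using p2 by simp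
  finally have "norm (deriv_term n b e (n + 1 + m) * Gamma z) \<le>
      1 / real (m + 1) * (norm (pochhammer b n) * (\<beta> * (\<beta> + 1) / y / real (m + 1)))"
    unfolding eq norm_mult[of "poch_deriv n (n + 1 + m)"] norm_mult[of "pochhammer b n"]
    using \<beta> y by (intro mult_mono mult_left_mono norm_poch_deriv_tail_le) auto
  thus ?thesis by (simp add: z_def y_def power2_eq_square mult_ac)
qed

text \<open>The normalisation divides by (e-b+N)_n / Gamma(e+N+n), the value of Gauss's sum at a =
  -n with e moved to e + N. The terms with k > n are O(1/N) in total, and each of the finitely many
  others tends to 0.\<close>

lemma suminf_deriv_term_limit:
  fixes b e :: complex
  shows "(\<lambda>N. (\<Sum>k. deriv_term n b (e + of_nat N) k) * Gamma (e + of_nat N + of_nat n)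
             / pochhammer (e - b + of_nat N) n) \<longlonglongrightarrow> 0"
proof -
  define \<beta> where "\<beta> = norm b + real n + 1"
  define M where "M = norm (pochhammer b n) * (\<beta> * (\<beta> + 1)) * (\<Sum>m. 1 / real (m + 1) ^ 2)"
  define y where "y = (\<lambda>N. Re (e + of_nat N + of_nat n))"
  define T where "T = (\<lambda>N m. deriv_term n b (e + of_nat N) (m + (n + 1)) * Gamma (e + of_nat N + of_nat n))"
  define P where "P = (\<lambda>N. pochhammer (e - b + of_nat N) n)"
  \<comment> \<open>From \<open>N0\<close> on, Re (e + N + n) >= \<open>\<beta> + 1\<close>, as the
    tail bound requires, and Re (e - b + N) >= 1, so that \<open>P N\<close> has norm at least
    1.\<close>
  define N0 where "N0 = nat \<lceil>\<bar>Re e\<bar> + norm b + \<beta> + 1\<rceil>"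
  have N0: "real N \<ge> \<bar>Re e\<bar> + norm b + \<beta> + 1" if "N \<ge> N0" for N
    using that unfolding N0_def by linarith
  have \<beta>: "\<beta> \<ge> 1" by (simp add: \<beta>_def)
  have "summable (\<lambda>m. inverse (real (Suc m) ^ 2))"
    using inverse_power_summable[of 2, where ?'a = real]
    by (subst summable_Suc_iff) simp
  hence sm: "summable (\<lambda>m. 1 / real (m + 1) ^ 2)" by (simp add: inverse_eq_divide)
  have y: "y N \<ge> \<beta> + 1" if "N \<ge> N0" for N
  proof -
    have "y N = Re e + real N + real n" by (simp add: y_def)
    thus ?thesis using N0[OF that] norm_ge_zero[of b] by linarith
  qed
  have P: "norm (P N) \<ge> 1" if "N \<ge> N0" for N
  proof -
    have "1 \<le> Re (e - b + of_nat N)"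
    proof -
      have "Re (e - b + of_nat N) = Re e - Re b + real N" by simp
      thus ?thesis using N0[OF that] \<beta> abs_Re_le_cmod[of b] by linarith
    qed
    hence "pochhammer 1 n \<le> norm (P N)" unfolding P_def by (intro norm_pochhammer_ge) auto
    thus ?thesis using fact_ge_1[of n, where ?'a = real] by (simp add: pochhammer_fact)
  qed
  have Tle: "norm (T N m) \<le> norm (pochhammer b n) * (\<beta> * (\<beta> + 1)) / y N * (1 / real (m + 1) ^ 2)" if "N \<ge> N0" for N m
    using norm_deriv_term_Gamma_le[of b n "e + of_nat N" m] y[OF that]
    by (simp add: T_def y_def \<beta>_def add_ac)
  have Ts: "summable (T N)" if "N \<ge> N0" for N
    by (rule summable_comparison_test'[OF summable_mult[OF sm] Tle[OF that]])
  have "norm (suminf (T N)) \<le> M / y N" if "N \<ge> N0" for N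
  proof -
    have "norm (suminf (T N)) \<le> (\<Sum>m. norm (pochhammer b n) * (\<beta> * (\<beta> + 1)) / y N * (1 / real (m + 1) ^ 2))"
      by (rule norm_suminf_le[OF Tle[OF that] summable_mult[OF sm]])
    also have "\<dots> = M / y N" unfolding M_def by (subst suminf_mult[OF sm]) simp
    finally show ?thesis .
  qed
  moreover have "M \<ge> 0" unfolding M_def using \<beta> by (intro mult_nonneg_nonneg suminf_nonneg sm) auto
  ultimately have TP: "norm (suminf (T N) / P N) \<le> M / y N" if "N \<ge> N0" for N
    using that P[OF that] y[OF that] \<beta> frac_le[of "M / y N" "norm (suminf (T N))" 1 "norm (P N)"]
    by (simp add: norm_divide)
  have "filterlim (\<lambda>N. Re e + real n + real N) at_top sequentially"
    by (rule filterlim_tendsto_add_at_top[OF tendsto_const filterlim_real_sequentially])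
  hence "filterlim y at_top sequentially" unfolding y_def by (simp add: add_ac)
  hence "(\<lambda>N. M / y N) \<longlonglongrightarrow> 0"
    by (intro real_tendsto_divide_at_top[OF tendsto_const])
  hence tail: "(\<lambda>N. suminf (T N) / P N) \<longlonglongrightarrow> 0"
    by (rule Lim_null_comparison[rotated], intro eventually_sequentiallyI[of N0] TP)
  have head: "(\<lambda>N. deriv_term n b (e + of_nat N) k * Gamma (e + of_nat N + of_nat n) / P N) \<longlonglongrightarrow> 0"
    if k: "k < n + 1" for k
  \<comment> \<open>The k-th term is a constant times (e+k+N)_{n-k} / (e-b+N)_n, of order N^(-k).
    This does not decay for k = 0, but there \<open>poch_deriv n 0\<close> is 0.\<close>
  proof (cases "k = 0")
    case False
    have "(\<lambda>N. (pochhammer (e + of_nat k + of_nat N) (n - k) / of_nat N ^ (n - k)) /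
         (pochhammer (e - b + of_nat N) n / of_nat N ^ n) * inverse (of_nat N) ^ k) \<longlonglongrightarrow> 1 / 1 * 0 ^ k"
      by (intro tendsto_intros tendsto_pochhammer_shift lim_inverse_n) auto
    also have "1 / 1 * 0 ^ k = (0 :: complex)" using False by simp
    finally have lim: "(\<lambda>N. poch_deriv n k * pochhammer b k * ((pochhammer (e + of_nat k + of_nat N) (n - k) / of_nat N ^ (n - k)) /
         (pochhammer (e - b + of_nat N) n / of_nat N ^ n) * inverse (of_nat N) ^ k)) \<longlonglongrightarrow> 0"
      by (rule tendsto_mult_right_zero)
    show ?thesis
    \<comment> \<open>Starting at \<open>N0 + 1\<close> makes N nonzero, so powers of N may be
      cancelled.\<close>
    proof (rule Lim_transform_eventually[OF lim], rule eventually_sequentiallyI[of "N0 + 1"])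
      fix N assume N: "N \<ge> N0 + 1"
      define z where "z = e + of_nat N + of_nat n"
      have "Re z > 0" using y[of N] \<beta> N by (simp add: z_def y_def)
      hence "z \<notin> \<int>\<^sub>\<le>\<^sub>0" by (rule Re_pos_notin_nonpos_Ints)
      hence z: "rGamma z * Gamma z = 1" by (simp add: Gamma_eq_zero_iff rGamma_inverse_Gamma)
      have "rGamma (e + of_nat N + of_nat k) = pochhammer (e + of_nat k + of_nat N) (n - k) * rGamma z"
        using pochhammer_rGamma[of "e + of_nat N + of_nat k" "n - k"] k by (simp add: of_nat_diff z_def add_ac)
      hence "rGamma (e + of_nat N + of_nat k) * Gamma z = pochhammer (e + of_nat k + of_nat N) (n - k)"
        using z by simp
      moreover have "(of_nat N :: complex) ^ n = of_nat N ^ (n - k) * of_nat N ^ k"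
        using k by (simp flip: power_add)
      ultimately show "poch_deriv n k * pochhammer b k * ((pochhammer (e + of_nat k + of_nat N) (n - k) / of_nat N ^ (n - k)) /
         (pochhammer (e - b + of_nat N) n / of_nat N ^ n) * inverse (of_nat N) ^ k) =
          deriv_term n b (e + of_nat N) k * Gamma (e + of_nat N + of_nat n) / P N"
        using N unfolding deriv_term_def P_def z_def[symmetric] by (simp add: field_simps)
    qed
  qed (simp add: deriv_term_def)
  have "(\<lambda>N. suminf (T N) / P N + (\<Sum>k<n+1. deriv_term n b (e + of_nat N) k * Gamma (e + of_nat N + of_nat n) / P N)) \<longlonglongrightarrow> 0 + (\<Sum>k<n+1. 0)"
    by (intro tendsto_add tail tendsto_sum head) auto
  hence lim: "(\<lambda>N. suminf (T N) / P N + (\<Sum>k<n+1. deriv_term n b (e + of_nat N) k * Gamma (e + of_nat N + of_nat n) / P N)) \<longlonglongrightarrow> 0" by simp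
  show ?thesis
  proof (rule Lim_transform_eventually[OF lim], rule eventually_sequentiallyI[of N0])
    fix N assume N: "N \<ge> N0"
    define G where "G = Gamma (e + of_nat N + of_nat n)"
    have "Re (e + of_nat N + of_nat n) > 0" using y[OF N] \<beta> by (simp add: y_def)
    hence "e + of_nat N + of_nat n \<notin> \<int>\<^sub>\<le>\<^sub>0" by (rule Re_pos_notin_nonpos_Ints)
    hence G: "G \<noteq> 0" by (simp add: G_def Gamma_eq_zero_iff)
    have s: "summable (\<lambda>m. deriv_term n b (e + of_nat N) (m + (n + 1)))"
      using summable_mult2[OF Ts[OF N], of "inverse G"] G unfolding T_def G_def[symmetric] by (simp add: mult.assoc)
    hence "(\<Sum>k. deriv_term n b (e + of_nat N) k) =
        (\<Sum>m. deriv_term n b (e + of_nat N) (m + (n + 1))) + (\<Sum>k<n+1. deriv_term n b (e + of_nat N) k)"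
      by (intro suminf_split_initial_segment) (subst (asm) summable_iff_shift)
    moreover have "suminf (T N) = (\<Sum>m. deriv_term n b (e + of_nat N) (m + (n + 1))) * G"
      unfolding T_def G_def[symmetric] by (rule suminf_mult2[OF s, symmetric])
    ultimately show "suminf (T N) / P N + (\<Sum>k<n+1. deriv_term n b (e + of_nat N) k * Gamma (e + of_nat N + of_nat n) / P N) =
        (\<Sum>k. deriv_term n b (e + of_nat N) k) * Gamma (e + of_nat N + of_nat n) / pochhammer (e - b + of_nat N) n"
      unfolding G_def[symmetric] P_def
      by (simp add: distrib_right add_divide_distrib sum_distrib_right sum_divide_distrib)
  qed
qed

section \<open>Closed form of the differentiated series\<close>

text \<open>Shifting the argument by N adds the sum of 1/(z+k) over k < N, and the limit formula for
  psi compares that sum with ln N. The logarithm cancels in a difference of two shifted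
  values.\<close>

lemma Digamma_shift_tendsto:
  fixes z :: complex
  assumes "z \<notin> \<int>\<^sub>\<le>\<^sub>0"
  shows "(\<lambda>N. Digamma (z + of_nat N) - of_real (ln (real N))) \<longlonglongrightarrow> 0"
proof -
  have "z \<noteq> 0" using assms by auto
  have "(\<lambda>N. Digamma z - (of_real (ln (real N)) - (\<Sum>k<N. inverse (z + of_nat k)))) \<longlonglongrightarrow> Digamma z - Digamma z"
    by (intro tendsto_diff tendsto_const Digamma_LIMSEQ \<open>z \<noteq> 0\<close>)
  moreover have "Digamma (z + of_nat N) = Digamma z + (\<Sum>k<N. inverse (z + of_nat k))" for N
    using Polygamma_plus_of_nat[of N z 0] assms by (auto simp: inverse_eq_divide)
  ultimately show ?thesis by (simp add: algebra_simps)
qed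

lemma pochhammer_swap:
  "pochhammer z N * pochhammer (z + of_nat N) n = pochhammer z n * pochhammer (z + of_nat n) N"
  by (simp flip: pochhammer_product' add: add.commute)

text \<open>The right-hand side is the a-derivative of Gauss's value: the logarithmic derivative of
  Gamma(e-a-b) / Gamma(e-a) is psi(e-a) - psi(e-a-b). The defect \<open>Y\<close>, scaled by
  Gamma(e+n), satisfies a homogeneous recurrence because both sides obey the same inhomogeneous
  one.\<close>

lemma suminf_deriv_term:
  fixes b e :: complex
  assumes z: "e + of_nat n \<notin> \<int>\<^sub>\<le>\<^sub>0" and pos: "Re (e - b + of_nat n) > 0"
  shows "(\<Sum>k. deriv_term n b e k) = pochhammer (e - b) n * rGamma (e + of_nat n) *
           (Digamma (e + of_nat n) - Digamma (e - b + of_nat n))"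
proof -
  define D where "D = (\<lambda>e. Digamma (e + of_nat n) - Digamma (e - b + of_nat n))"
  define Y where "Y = (\<lambda>e. (\<Sum>k. deriv_term n b e k) * Gamma (e + of_nat n) - pochhammer (e - b) n * D e)"
  have shift: "e + of_nat N + of_nat n \<notin> \<int>\<^sub>\<le>\<^sub>0" for N
    using z nonpos_Ints_diff_Nats[of "e + of_nat N + of_nat n" "of_nat N"] by auto
  have step: "(x - b + of_nat n) * Y x = (x - b) * Y (x + 1)"
    if x: "x + of_nat n \<notin> \<int>\<^sub>\<le>\<^sub>0" "x + of_nat n + 1 \<notin> \<int>\<^sub>\<le>\<^sub>0" "x + of_nat n + 2 \<notin> \<int>\<^sub>\<le>\<^sub>0" "Re (x - b + of_nat n) > 0" for x
  proof -
    define z w p p1 H H1 where "z = x + of_nat n" and "w = x - b + of_nat n"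
      and "p = pochhammer (x - b) n" and "p1 = pochhammer (x + 1 - b) n"
      and "H = (\<Sum>k. deriv_term n b x k)" and "H1 = (\<Sum>k. deriv_term n b (x + 1) k)"
    have nz: "z \<noteq> 0" "w \<noteq> 0" using x(1) Re_pos_notin_nonpos_Ints[OF x(4)] unfolding z_def w_def by (metis zero_in_nonpos_Ints)+
    have G: "Gamma (x + 1 + of_nat n) = z * Gamma z"
      using Gamma_plus1[of z] x by (simp add: z_def add_ac)
    have rG: "rGamma z = z * rGamma (x + 1 + of_nat n)"
      using rGamma_plus1[of z] by (simp add: z_def add_ac)
    have rG1: "rGamma z * Gamma z = 1"
      using x by (simp add: z_def Gamma_eq_zero_iff rGamma_inverse_Gamma)
    have p: "w * p = (x - b) * p1"
      using pochhammer_rec[of "x - b" n] pochhammer_rec'[of "x - b" n]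
      by (simp add: p_def p1_def w_def algebra_simps)
    have D1: "D (x + 1) = D x + 1 / z - 1 / w"
      using Digamma_plus1[OF nz(1)] Digamma_plus1[OF nz(2)] by (simp add: D_def z_def w_def algebra_simps)
    have "(x + of_nat n - b) * H - p * rGamma z = z * (x - b) * H1 - (x - b) * (p1 * rGamma (x + 1 + of_nat n))"
      using suminf_deriv_term_recurrence[OF x(2,3,4)] by (simp add: z_def p_def p1_def H_def H1_def)
    also have "x + of_nat n - b = w" by (simp add: w_def)
    \<comment> \<open>The factor z Gamma(z) clears the reciprocal Gamma values through
      \<open>rG\<close> and \<open>rG1\<close>.\<close>
    finally have "z * ((w * H - p * rGamma z) * Gamma z) =
        z * ((z * (x - b) * H1 - (x - b) * (p1 * rGamma (x + 1 + of_nat n))) * Gamma z)" by simp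
    hence "z * (w * H * Gamma z) - z * p * (rGamma z * Gamma z) =
        z * ((x - b) * H1 * (z * Gamma z)) - (x - b) * p1 * ((z * rGamma (x + 1 + of_nat n)) * Gamma z)"
      by (simp add: algebra_simps)
    hence "z * (w * H * Gamma z) - z * p = z * ((x - b) * H1 * (z * Gamma z)) - w * p"
      unfolding rG[symmetric] rG1 p by simp
    hence "w * H * Gamma z = (x - b) * H1 * (z * Gamma z) - w * p / z + p"
      using nz by (simp add: field_simps)
    \<comment> \<open>The digamma side has the same inhomogeneous part -wp/z + p as the series, so
      it drops out of \<open>Y\<close>.\<close>
    moreover have "w * p * D x = (x - b) * p1 * D (x + 1) - w * p / z + p"
      unfolding D1 p[symmetric] using nz by (simp add: field_simps)
    moreover have "w * Y x = w * H * Gamma z - w * p * D x"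
      by (simp add: Y_def H_def z_def p_def algebra_simps)
    moreover have "(x - b) * Y (x + 1) = (x - b) * H1 * (z * Gamma z) - (x - b) * p1 * D (x + 1)"
      unfolding Y_def G by (simp add: H1_def p1_def algebra_simps)
    ultimately have "w * Y x = (x - b) * Y (x + 1)" by simp
    thus ?thesis by (simp add: w_def)
  qed
  have iter: "pochhammer (e - b + of_nat n) N * Y e = pochhammer (e - b) N * Y (e + of_nat N)" for N
  proof (induction N)
    case (Suc N)
    have "(e + of_nat N - b + of_nat n) * Y (e + of_nat N) = (e + of_nat N - b) * Y (e + of_nat N + 1)"
      using shift[of N] shift[of "N + 1"] shift[of "N + 2"] pos by (intro step) (auto simp: add_ac)
    moreover have "pochhammer (e - b) (Suc N) * Y (e + of_nat (Suc N)) =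
        pochhammer (e - b) N * ((e + of_nat N - b) * Y (e + of_nat N + 1))"
      by (simp add: pochhammer_rec' algebra_simps)
    moreover have "pochhammer (e - b + of_nat n) (Suc N) * Y e =
        (e + of_nat N - b + of_nat n) * (pochhammer (e - b + of_nat n) N * Y e)"
      by (simp add: pochhammer_rec' algebra_simps)
    ultimately show ?case unfolding Suc.IH by (metis mult.left_commute)
  qed simp
  have wnz: "e - b + of_nat n \<notin> \<int>\<^sub>\<le>\<^sub>0" using pos by (rule Re_pos_notin_nonpos_Ints)
  \<comment> \<open>(e-b)_N may vanish, so \<open>iter\<close> is not solved for Y(e+N). Multiplying
    by (e-b+N)_n and applying \<open>pochhammer_swap\<close> produces (e-b+n)_N on both sides, which
    is nonzero and cancels.\<close>
  have lift: "pochhammer (e - b + of_nat N) n * Y e = pochhammer (e - b) n * Y (e + of_nat N)" for N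
  proof -
    have "pochhammer (e - b + of_nat n) N \<noteq> 0" using wnz by (auto simp: pochhammer_eq_0_iff)
    moreover have "pochhammer (e - b + of_nat n) N * (pochhammer (e - b + of_nat N) n * Y e) =
        pochhammer (e - b + of_nat N) n * (pochhammer (e - b + of_nat n) N * Y e)" by (simp only: mult_ac)
    moreover have "\<dots> = (pochhammer (e - b) N * pochhammer (e - b + of_nat N) n) * Y (e + of_nat N)"
      unfolding iter by (simp only: mult_ac)
    moreover have "\<dots> = pochhammer (e - b + of_nat n) N * (pochhammer (e - b) n * Y (e + of_nat N))"
      unfolding pochhammer_swap[of "e - b" N n] by (simp only: mult_ac)
    ultimately show ?thesis by simp
  qed
  have "(\<lambda>N. Digamma (e + of_nat n + of_nat N) - of_real (ln (real N)) -
      (Digamma (e - b + of_nat n + of_nat N) - of_real (ln (real N)))) \<longlonglongrightarrow> 0 - 0"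
    by (intro tendsto_diff Digamma_shift_tendsto z wnz)
  hence D: "(\<lambda>N. D (e + of_nat N)) \<longlonglongrightarrow> 0" by (simp add: D_def algebra_simps)
  \<comment> \<open>\<open>L N\<close> is Y(e+N) / (e-b+N)_n wherever the denominator is nonzero. By
    \<open>lift\<close>, (e-b)_n times it is then the constant Y(e), while it tends to 0.\<close>
  define L where "L = (\<lambda>N. (\<Sum>k. deriv_term n b (e + of_nat N) k) * Gamma (e + of_nat N + of_nat n)
             / pochhammer (e - b + of_nat N) n - D (e + of_nat N))"
  have "L \<longlonglongrightarrow> 0 - 0"
    unfolding L_def by (intro tendsto_diff suminf_deriv_term_limit D)
  hence lim: "(\<lambda>N. pochhammer (e - b) n * L N) \<longlonglongrightarrow> 0"
    by (intro tendsto_mult_right_zero) simp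
  have "pochhammer (e - b) n * L N = Y e" if "N \<ge> n" for N
  proof -
    define P where "P = pochhammer (e - b + of_nat N) n"
    have "Re (e - b + of_nat N) \<ge> Re (e - b + of_nat n)" using that by simp
    hence "e - b + of_nat N \<notin> \<int>\<^sub>\<le>\<^sub>0" using pos by (intro Re_pos_notin_nonpos_Ints) linarith
    hence P: "P \<noteq> 0" by (auto simp: P_def pochhammer_eq_0_iff)
    have "e + of_nat N - b = e - b + of_nat N" by simp
    hence "Y (e + of_nat N) =
        (\<Sum>k. deriv_term n b (e + of_nat N) k) * Gamma (e + of_nat N + of_nat n) - P * D (e + of_nat N)"
      by (simp only: Y_def P_def)
    hence "L N = Y (e + of_nat N) / P"
      using P by (simp add: L_def P_def[symmetric] diff_divide_distrib)
    hence "pochhammer (e - b) n * L N = P * Y e / P"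
      unfolding P_def lift by simp
    thus ?thesis using P by simp
  qed
  hence "eventually (\<lambda>N. pochhammer (e - b) n * L N = Y e) sequentially"
    by (intro eventually_sequentiallyI[of n])
  with lim have "(\<lambda>N. Y e) \<longlonglongrightarrow> 0"
    by (rule Lim_transform_eventually)
  hence "Y e = 0" by (simp add: LIMSEQ_const_iff)
  hence "(\<Sum>k. deriv_term n b e k) * Gamma (e + of_nat n) = pochhammer (e - b) n * D e"
    by (simp add: Y_def)
  moreover have "rGamma (e + of_nat n) * Gamma (e + of_nat n) = 1"
    using z by (simp add: Gamma_eq_zero_iff rGamma_inverse_Gamma)
  hence "(\<Sum>k. deriv_term n b e k) =
      (\<Sum>k. deriv_term n b e k) * Gamma (e + of_nat n) * rGamma (e + of_nat n)"
    by (simp add: mult.assoc mult.commute[of "Gamma _"])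
  ultimately show ?thesis by (simp add: D_def mult_ac)
qed

section \<open>Identification with the hypergeometric series and the finite sum\<close>

text \<open>The Euler-Mascheroni constant cancels in the digamma difference, leaving H_n - H_{n-k}.
  The k! in \<open>D_coeff\<close> is absorbed by (-1)^k (b)_k = k! binom(-b, k).\<close>

lemma poch_deriv_D_coeff:
  assumes "k \<le> n"
  shows "poch_deriv n k * pochhammer b k = - ((of_nat n gchoose k) * ((- b) gchoose k) * D_coeff n k)"
proof -
  have "Digamma (of_nat n + 1 :: complex) = harm n - euler_mascheroni"
    using Digamma_of_nat[of n, where ?'a = complex] by (simp add: add.commute)
  moreover have "Digamma (of_nat n + 1 - of_nat k :: complex) = harm (n - k) - euler_mascheroni"
    using Digamma_of_nat[of "n - k", where ?'a = complex] assms by (simp add: of_nat_diff algebra_simps)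
  ultimately have "D_coeff n k = fact k * (harm n - harm (n - k))" by (simp add: D_coeff_def)
  thus ?thesis
    unfolding poch_deriv_le[OF assms] by (simp add: binomial_gbinomial gbinomial_pochhammer[of "- b"])
qed

theorem theorem1:
  fixes n :: nat and c d :: complex
  assumes "Re (d - c + of_nat n) > 0"
    and "d \<notin> insert 1 \<int>\<^sub>\<le>\<^sub>0"
    and "c \<notin> of_nat ` {1..n+1}"
  shows "summable (hypergeom_3F2_term 1 1 c d (of_nat n + 2) 1) \<and>
    hypergeom_3F2 1 1 c d (of_nat n + 2) 1 =
      (of_nat n + 1) * Gamma d / pochhammer (1 - c) (n + 1) *
      (pochhammer (d - c) n * rGamma (d - 1) *
         (Digamma (d - c + of_nat n) - Digamma (d - 1))
       - (\<Sum>k=1..n. (of_nat n gchoose k) * ((of_nat n + 1 - c) gchoose k) *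
            D_coeff n k * rGamma (d - of_nat n - 1 + of_nat k)))"
proof
  define b e where "b = c - of_nat n - 1" and "e = d - of_nat n - 1"
  have d: "d \<notin> \<int>\<^sub>\<le>\<^sub>0" using assms by auto
  \<comment> \<open>d - 1 is e + n, where the closed form needs a finite Gamma value; hence d = 1 is
    excluded along with the nonpositive integers.\<close>
  have d1: "d - 1 \<notin> \<int>\<^sub>\<le>\<^sub>0"
  proof
    assume "d - 1 \<in> \<int>\<^sub>\<le>\<^sub>0"
    then obtain k where k: "d - 1 = - of_nat k" by (elim nonpos_Ints_cases')
    show False
    proof (cases k)
      case (Suc j)
      hence "d = - of_nat j" using k by (simp add: eq_neg_iff_add_eq_0)
      thus False using d by simp
    qed (use k assms in simp)
  qed
  have c: "pochhammer (1 - c) (n + 1) \<noteq> 0"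
  proof
    assume "pochhammer (1 - c) (n + 1) = 0"
    then obtain k where "k < n + 1" "1 - c = - of_nat k" by (auto simp: pochhammer_eq_0_iff)
    hence "c = of_nat (k + 1)" "k + 1 \<in> {1..n+1}" by (auto simp: algebra_simps)
    thus False using assms(3) by blast
  qed
  show summ: "summable (hypergeom_3F2_term 1 1 c d (of_nat n + 2) 1)"
    using d assms(1) by (rule summable_hypergeom_3F2_term)
  define S where "S = (\<Sum>k=1..n. (of_nat n gchoose k) * ((of_nat n + 1 - c) gchoose k) *
            D_coeff n k * rGamma (d - of_nat n - 1 + of_nat k))"
  \<comment> \<open>The constant of \<open>poch_deriv_tail\<close>; the prefactor in the theorem is
    -1/q.\<close>
  define q where "q = - pochhammer (1 - c) (n + 1) * rGamma d / (of_nat n + 1)"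
  have "(\<Sum>k. deriv_term n b e k) = (\<Sum>m. deriv_term n b e (m + (n + 1))) + (\<Sum>k<n+1. deriv_term n b e k)"
    using d assms(1) by (intro suminf_split_initial_segment summable_deriv_term) (auto simp: b_def e_def)
  also have "(\<lambda>m. deriv_term n b e (m + (n + 1))) = (\<lambda>m. q * hypergeom_3F2_term 1 1 c d (of_nat n + 2) 1 m)"
    using poch_deriv_tail[OF d, of n _ c] by (simp add: deriv_term_def b_def e_def q_def add_ac)
  also have "suminf \<dots> = q * hypergeom_3F2 1 1 c d (of_nat n + 2) 1"
    unfolding hypergeom_3F2_def by (rule suminf_mult[OF summ])
  \<comment> \<open>The k = 0 term vanishes because (a)_0 = 1 is constant in a.\<close>
  also have "(\<Sum>k<n+1. deriv_term n b e k) = (\<Sum>k=1..n. deriv_term n b e k)"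
    by (rule sum.mono_neutral_right) (auto simp: deriv_term_def not_less_eq_eq)
  also have "\<dots> = - S"
    unfolding S_def sum_negf[symmetric]
  proof (intro sum.cong refl)
    fix k assume "k \<in> {1..n}"
    moreover have "- b = of_nat n + 1 - c" by (simp add: b_def)
    ultimately show "deriv_term n b e k = - ((of_nat n gchoose k) * ((of_nat n + 1 - c) gchoose k) *
            D_coeff n k * rGamma (d - of_nat n - 1 + of_nat k))"
      using poch_deriv_D_coeff[of k n b] by (simp add: deriv_term_def e_def)
  qed
  also have "(\<Sum>k. deriv_term n b e k) = pochhammer (d - c) n * rGamma (d - 1) *
         (Digamma (d - 1) - Digamma (d - c + of_nat n))"
    using suminf_deriv_term[of e n b] d1 assms(1) by (simp add: b_def e_def)
  finally have "- q * hypergeom_3F2 1 1 c d (of_nat n + 2) 1 = pochhammer (d - c) n * rGamma (d - 1) *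
         (Digamma (d - c + of_nat n) - Digamma (d - 1)) - S"
    by (simp add: algebra_simps)
  moreover have "(of_nat n + 1) * Gamma d / pochhammer (1 - c) (n + 1) * - q = 1"
  proof -
    have "(of_nat n + 1 :: complex) \<noteq> 0" by (metis of_nat_Suc of_nat_neq_0 add.commute)
    moreover have "Gamma d \<noteq> 0" using d by (simp add: Gamma_eq_zero_iff)
    ultimately show ?thesis using c by (simp add: q_def rGamma_inverse_Gamma del: pochhammer_Suc)
  qed
  ultimately show "hypergeom_3F2 1 1 c d (of_nat n + 2) 1 =
      (of_nat n + 1) * Gamma d / pochhammer (1 - c) (n + 1) *
      (pochhammer (d - c) n * rGamma (d - 1) *
         (Digamma (d - c + of_nat n) - Digamma (d - 1)) - S)"
    by (metis mult.assoc mult_1)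
qed

end
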